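(* Let $\Omega_1,\Omega_2\subset\mathbb{R}^2$ be compact sets starshaped with respect to the origin, with radial functions $f_{\Omega_1},f_{\Omega_2}$ satisfying $f_{\Omega_1}\ge r_0$ and $f_{\Omega_2}\ge r_0$ on $[0,2\pi)$ for some $r_0>0$. Then (1) $|h(\Omega_1)-h(\Omega_2)|\leq \frac{2}{r_0^2}\|f_{\Omega_1}-f_{\Omega_2}\|_\infty$; (2) $\big||\Omega_1|-|\Omega_2|\big|\leq 2\pi\max(\|f_{\Omega_1}\|_\infty,\|f_{\Omega_2}\|_\infty)\,\|f_{\Omega_1}-f_{\Omega_2}\|_\infty$, where $\|\cdot\|_\infty$ is the supremum norm over $[0,2\pi)$.
   Context: A set $\Omega$ is starshaped with respect to the origin if it is non-empty and for every $M\in\Omega$ the segment $[0,M]$ is contained in $\Omega$. Its radial function is $f_\Omega(\theta)=\max\{\lambda\ge0 : \lambda(\cos\theta,\sin\theta)\in\Omega\}$ for $\theta\in[0,2\pi)$. $|\cdot|$ is Lebesgue measure, and $h(\Omega)=\inf\{P(E)/|E| : E\subset\Omega\text{ measurable}\}$ is the Cheeger constant, $P$ being the perimeter. *)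

theory Defs
  imports "HOL-Analysis.Analysis"
begin

text \<open>Starshaped with respect to the origin (as in the paper).\<close>
definition starshaped0 :: "(real^2) set \<Rightarrow> bool" where
  "starshaped0 \<Omega> \<longleftrightarrow> \<Omega> \<noteq> {} \<and> (\<forall>M\<in>\<Omega>. closed_segment 0 M \<subseteq> \<Omega>)"

text \<open>Unit vector in direction theta.\<close>
definition dir :: "real \<Rightarrow> real^2" where
  "dir \<theta> = vector [cos \<theta>, sin \<theta>]"

text \<open>Radial function: f(theta) = max {lambda >= 0 : lambda (cos theta, sin theta) in Omega}.\<close>
definition radial_fun :: "(real^2) set \<Rightarrow> real \<Rightarrow> real" where
  "radial_fun \<Omega> \<theta> = Sup {l. l \<ge> 0 \<and> l *\<^sub>R dir \<theta> \<in> \<Omega>}"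

text \<open>Supremum norm over [0, 2 pi).\<close>
definition sup_norm :: "(real \<Rightarrow> real) \<Rightarrow> real" where
  "sup_norm f = (SUP \<theta>\<in>{0..<2*pi}. \<bar>f \<theta>\<bar>)"

text \<open>Divergence of a vector field on R^2.\<close>
definition divergence :: "(real^2 \<Rightarrow> real^2) \<Rightarrow> real^2 \<Rightarrow> real" where
  "divergence \<phi> x = (\<Sum>i\<in>UNIV. frechet_derivative \<phi> (at x) (axis i 1) $ i)"

text \<open>Admissible test fields: C^1 with compact support, pointwise norm at most 1.\<close>
definition test_field :: "(real^2 \<Rightarrow> real^2) \<Rightarrow> bool" where
  "test_field \<phi> \<longleftrightarrow>
     (\<forall>x. \<phi> differentiable (at x)) \<and>
     (\<forall>i j. continuous_on UNIV (\<lambda>x. frechet_derivative \<phi> (at x) (axis i 1) $ j)) \<and>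
     compact (closure {x. \<phi> x \<noteq> 0}) \<and>
     (\<forall>x. norm (\<phi> x) \<le> 1)"

text \<open>De Giorgi perimeter: P(E) = sup { integral over E of div phi : phi admissible }.\<close>
definition perimeter :: "(real^2) set \<Rightarrow> ereal" where
  "perimeter E = (SUP \<phi>\<in>{\<phi>. test_field \<phi>}.
      ereal (integral\<^sup>L lebesgue (\<lambda>x. indicator E x * divergence \<phi> x)))"

text \<open>Cheeger constant: inf { P(E)/|E| : E subset Omega measurable, |E| > 0 }.\<close>
definition cheeger :: "(real^2) set \<Rightarrow> ereal" where
  "cheeger \<Omega> = (INF E\<in>{E. E \<in> sets lebesgue \<and> E \<subseteq> \<Omega> \<and> measure lebesgue E > 0}.
      perimeter E / ereal (measure lebesgue E))"

end

(* Write f1, f2 for the radial functions, eps for the sup norm of f1 - f2 and M for the larger of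
   the sup norms of f1 and f2.

   Area: the map (s, theta) |-> sqrt (2 s) (cos theta, sin theta) preserves Lebesgue measure and
   carries the region {s <= f(theta)^2 / 2} onto the starshaped set minus the origin. The regions of
   Omega1 and Omega2 differ by a set lying between the graphs of f2^2 / 2 and f2^2 / 2 + M eps over
   [0, 2 pi], whose area is at most 2 pi M eps.

   Cheeger constant: starshapedness gives Omega1 <= (1 + eps / r0) Omega2 and vice versa. The Cheeger
   constant is antitone under inclusion and h (t Omega) >= h Omega / t, because perimeters scale like t
   and areas like t^2. Both constants are at most the ratio for the disc of radius r0, which is 2 / r0
   since the divergence theorem in polar coordinates bounds the perimeter of the disc by 2 pi r0.
   Hence |h Omega1 - h Omega2| <= (2 / r0) (eps / r0). *)

theory Submission
  imports Defs
begin

section \<open>Boxes in the plane\<close>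

lemma vec2_eq_iff: "(x::real^2) = y \<longleftrightarrow> x$1 = y$1 \<and> x$2 = y$2"
  by (simp add: vec_eq_iff forall_2)

lemma measure_cbox_vec2:
  assumes "a$1 \<le> b$1" "a$2 \<le> b$2"
  shows "measure lebesgue (cbox a (b::real^2)) = (b$1 - a$1) * (b$2 - a$2)"
proof -
  have "cbox a b \<noteq> {}"
    using assms by (auto simp: mem_box_cart forall_2)
  then show ?thesis
    by (simp add: content_cbox_cart UNIV_2)
qed

definition vec_of_pair :: "real \<times> real \<Rightarrow> real^2" where
  "vec_of_pair z = vector [fst z, snd z]"

definition pair_of_vec :: "real^2 \<Rightarrow> real \<times> real" where
  "pair_of_vec x = (x$1, x$2)"

lemma vec_of_pair_nth [simp]: "vec_of_pair z $ 1 = fst z" "vec_of_pair z $ 2 = snd z"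
  by (simp_all add: vec_of_pair_def)

lemma pair_of_vec_inverse [simp]: "pair_of_vec (vec_of_pair z) = z" "vec_of_pair (pair_of_vec x) = x"
  by (simp_all add: pair_of_vec_def vec2_eq_iff)

lemma mem_cbox_pair:
  "(z::real \<times> real) \<in> cbox u v \<longleftrightarrow> fst u \<le> fst z \<and> fst z \<le> fst v \<and> snd u \<le> snd z \<and> snd z \<le> snd v"
  by (cases z; cases u; cases v) (simp add: cbox_Pair_eq)

lemma image_vec_of_pair_cbox: "vec_of_pair ` cbox u v = cbox (vec_of_pair u) (vec_of_pair v)"
proof -
  have "x \<in> vec_of_pair ` cbox u v \<longleftrightarrow> pair_of_vec x \<in> cbox u v" for x
    by (metis image_iff pair_of_vec_inverse)
  then show ?thesis
    by (auto simp: mem_cbox_pair mem_box_cart forall_2 pair_of_vec_def)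
qed

lemma image_pair_of_vec_cbox: "pair_of_vec ` cbox c d = cbox (pair_of_vec c) (pair_of_vec d)"
proof -
  have "z \<in> pair_of_vec ` cbox c d \<longleftrightarrow> vec_of_pair z \<in> cbox c d" for z
    by (metis image_iff pair_of_vec_inverse)
  then show ?thesis
    by (auto simp: mem_cbox_pair mem_box_cart forall_2 pair_of_vec_def)
qed

lemma measure_image_vec_of_pair_cbox:
  "measure lborel (vec_of_pair ` cbox u v) = measure lborel (cbox u v)"
proof (cases "fst u \<le> fst v \<and> snd u \<le> snd v")
  case True
  then show ?thesis
    using measure_cbox_vec2[of "vec_of_pair u" "vec_of_pair v"]
    by (cases u; cases v) (simp add: image_vec_of_pair_cbox content_Pair)
next
  case False
  then have "cbox (vec_of_pair u) (vec_of_pair v) = {}" "cbox u v = {}"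
    by (auto simp: mem_box_cart forall_2 mem_cbox_pair)
  then show ?thesis
    by (simp add: image_vec_of_pair_cbox)
qed

lemma integral_cbox_vec2:
  fixes F :: "real^2 \<Rightarrow> real"
  assumes "F integrable_on cbox a b"
  shows "integral (cbox a b) F = integral (cbox (pair_of_vec a) (pair_of_vec b)) (\<lambda>z. F (vec_of_pair z))"
proof -
  have "((\<lambda>z. F (vec_of_pair z)) has_integral (1 / 1) *\<^sub>R integral (cbox a b) F) (pair_of_vec ` cbox a b)"
  proof (rule has_integral_twiddle)
    have linear: "vec_of_pair = (\<lambda>z. fst z *\<^sub>R axis 1 1 + snd z *\<^sub>R axis 2 1)"
      by (simp add: fun_eq_iff vec2_eq_iff axis_def)
    show "continuous (at z) vec_of_pair" for z
      unfolding linear by (intro continuous_intros)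
    show "\<exists>w z. vec_of_pair ` cbox u v = cbox w z" "\<exists>w z. pair_of_vec ` cbox c d = cbox w z" for u v c d
      using image_vec_of_pair_cbox image_pair_of_vec_cbox by blast+
  qed (use assms measure_image_vec_of_pair_cbox in auto)
  then show ?thesis
    by (simp add: image_pair_of_vec_cbox integral_unique)
qed

section \<open>Polar coordinates\<close>

lemma dir_nth [simp]: "dir t $ 1 = cos t" "dir t $ 2 = sin t"
  by (simp_all add: dir_def)

lemma norm_dir [simp]: "norm (dir t) = 1"
  by (simp add: norm_vec_def L2_set_def sum_2 dir_def)

lemma dir_nonzero [simp]: "dir t \<noteq> 0"
  using norm_dir[of t] by (metis norm_zero zero_neq_one)

lemma dir_eq_axis: "dir t = cos t *\<^sub>R axis 1 1 + sin t *\<^sub>R axis 2 1"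
  by (simp add: vec2_eq_iff axis_def)

definition dir_perp :: "real \<Rightarrow> real^2" where
  "dir_perp t = vector [- sin t, cos t]"

lemma dir_perp_nth [simp]: "dir_perp t $ 1 = - sin t" "dir_perp t $ 2 = cos t"
  by (simp_all add: dir_perp_def)

lemma dir_perp_eq_axis: "dir_perp t = (- sin t) *\<^sub>R axis 1 1 + cos t *\<^sub>R axis 2 1"
  by (simp add: vec2_eq_iff axis_def)

lemma has_derivative_vec_nth [derivative_intros]:
  "((\<lambda>v. v $ i) has_derivative (\<lambda>h. h $ i)) (at v within S)"
  by (simp add: bounded_linear_imp_has_derivative bounded_linear_vec_nth)

lemma continuous_on_dir [continuous_intros]:
  fixes f :: "'a::t2_space \<Rightarrow> real"
  assumes "continuous_on S f"
  shows "continuous_on S (\<lambda>x. dir (f x))"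
  unfolding dir_eq_axis by (intro continuous_intros assms)

lemma continuous_on_dir_perp [continuous_intros]:
  fixes f :: "'a::t2_space \<Rightarrow> real"
  assumes "continuous_on S f"
  shows "continuous_on S (\<lambda>x. dir_perp (f x))"
  unfolding dir_perp_eq_axis by (intro continuous_intros assms)

lemma has_derivative_dir [derivative_intros]:
  "(dir has_derivative (\<lambda>h. h *\<^sub>R dir_perp t)) (at t within S)"
  unfolding dir_eq_axis[abs_def] dir_perp_eq_axis
  by (rule derivative_eq_intros refl | simp add: algebra_simps)+

lemma has_derivative_dir_perp [derivative_intros]:
  "(dir_perp has_derivative (\<lambda>h. - h *\<^sub>R dir t)) (at t within S)"
  unfolding dir_eq_axis dir_perp_eq_axis[abs_def]
  by (rule derivative_eq_intros refl | simp add: algebra_simps)+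

lemma polar_decomposition:
  fixes x :: "real^2"
  obtains t where "0 \<le> t" "t < 2*pi" "x = norm x *\<^sub>R dir t"
proof (cases "x = 0")
  case True
  then show ?thesis using that[of 0] by simp
next
  case False
  then have n: "norm x > 0" by simp
  have "(x$1)^2 + (x$2)^2 = (norm x)^2"
    by (simp add: norm_vec_def L2_set_def sum_2)
  then have "(x$1 / norm x)^2 + (x$2 / norm x)^2 = 1"
    using n by (simp add: power_divide add_divide_distrib[symmetric])
  then obtain t where t: "0 \<le> t" "t < 2*pi" "x$1 / norm x = cos t" "x$2 / norm x = sin t"
    by (rule sincos_total_2pi)
  then have "x$1 = norm x * cos t" "x$2 = norm x * sin t"
    using n by (simp_all add: divide_eq_eq mult.commute)
  then have "x = norm x *\<^sub>R dir t"
    by (simp add: vec2_eq_iff)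
  then show ?thesis using that t by blast
qed

lemma scaleR_dir_eq_iff:
  assumes "0 < a" "0 < b" "0 \<le> s" "s < 2*pi" "0 \<le> t" "t < 2*pi"
  shows "a *\<^sub>R dir s = b *\<^sub>R dir t \<longleftrightarrow> a = b \<and> s = t"
proof
  assume eq: "a *\<^sub>R dir s = b *\<^sub>R dir t"
  have "norm (a *\<^sub>R dir s) = norm (b *\<^sub>R dir t)"
    using eq by simp
  then have "a = b"
    using assms by simp
  with eq have "cis s = cis t"
    using assms(1) by (simp add: complex_eq_iff vec2_eq_iff)
  have "s = Arg2pi (cis s)"
    by (rule Arg2pi_unique[of 1, symmetric]) (use assms in \<open>simp_all add: cis_conv_exp\<close>)
  also have "\<dots> = Arg2pi (cis t)"
    by (simp only: \<open>cis s = cis t\<close>)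
  also have "\<dots> = t"
    by (rule Arg2pi_unique[of 1]) (use assms in \<open>simp_all add: cis_conv_exp\<close>)
  finally have "s = t" .
  with \<open>a = b\<close> show "a = b \<and> s = t" ..
qed simp

definition polar_domain :: "(real^2) set" where
  "polar_domain = {v. 0 < v$1 \<and> 0 \<le> v$2 \<and> v$2 < 2*pi}"

lemma polar_domain_borel: "polar_domain \<in> sets borel"
  unfolding polar_domain_def by measurable

definition polar :: "real^2 \<Rightarrow> real^2" where
  "polar v = v$1 *\<^sub>R dir (v$2)"

definition polar_deriv :: "real^2 \<Rightarrow> real^2 \<Rightarrow> real^2" where
  "polar_deriv v h = h$1 *\<^sub>R dir (v$2) + (v$1 * h$2) *\<^sub>R dir_perp (v$2)"

lemma continuous_on_polar: "continuous_on S polar"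
  unfolding polar_def[abs_def] by (intro continuous_intros)

lemma has_derivative_polar: "(polar has_derivative polar_deriv v) (at v within S)"
proof -
  have "(polar has_derivative (\<lambda>h. v$1 *\<^sub>R (h$2 *\<^sub>R dir_perp (v$2)) + h$1 *\<^sub>R dir (v$2))) (at v within S)"
    unfolding polar_def[abs_def]
    by (intro has_derivative_scaleR has_derivative_vec_nth has_derivative_compose[OF has_derivative_vec_nth has_derivative_dir])
  then show ?thesis
    by (rule has_derivative_eq_rhs) (auto simp: polar_deriv_def algebra_simps fun_eq_iff)
qed

lemma det_polar_deriv: "det (matrix (polar_deriv v)) = v$1"
proof -
  have "v$1 * (cos (v$2) * cos (v$2)) + v$1 * (sin (v$2) * sin (v$2)) = v$1"
    by (metis distrib_left mult_1_right sin_cos_squared_add3)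
  then show ?thesis
    by (simp add: det_2 matrix_def polar_deriv_def axis_def algebra_simps)
qed

lemma norm_polar: "0 \<le> v$1 \<Longrightarrow> norm (polar v) = v$1"
  by (simp add: polar_def)

lemma inj_on_polar: "inj_on polar polar_domain"
proof (rule inj_onI)
  fix v w
  assume "v \<in> polar_domain" "w \<in> polar_domain" "polar v = polar w"
  then have "v$1 = w$1 \<and> v$2 = w$2"
    unfolding polar_def polar_domain_def by (subst (asm) scaleR_dir_eq_iff) auto
  then show "v = w"
    by (simp add: vec2_eq_iff)
qed

lemma polar_image: "polar ` polar_domain = - {0}"
proof
  show "polar ` polar_domain \<subseteq> - {0}"
    by (auto simp: polar_def polar_domain_def)
  show "- {0} \<subseteq> polar ` polar_domain"
  proof
    fix x :: "real^2"
    assume "x \<in> - {0}"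
    obtain t where t: "0 \<le> t" "t < 2*pi" "x = norm x *\<^sub>R dir t"
      by (rule polar_decomposition)
    have "polar (vector [norm x, t]) = x"
      by (simp add: polar_def t(3)[symmetric])
    moreover have "vector [norm x, t] \<in> polar_domain"
      using \<open>x \<in> - {0}\<close> t(1,2) by (simp add: polar_domain_def)
    ultimately show "x \<in> polar ` polar_domain"
      by (metis image_eqI)
  qed
qed

text \<open>Polar coordinates \<open>(s, \<theta>)\<close> with \<open>s = \<rho>\<^sup>2 / 2\<close> in place of the radius \<open>\<rho>\<close>: this
  parametrisation has Jacobian determinant 1.\<close>

definition polar_area :: "real^2 \<Rightarrow> real^2" where
  "polar_area v = sqrt (2 * v$1) *\<^sub>R dir (v$2)"

definition polar_area_deriv :: "real^2 \<Rightarrow> real^2 \<Rightarrow> real^2" where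
  "polar_area_deriv v h =
     (h$1 / sqrt (2 * v$1)) *\<^sub>R dir (v$2) + (sqrt (2 * v$1) * h$2) *\<^sub>R dir_perp (v$2)"

lemma continuous_on_polar_area: "continuous_on UNIV polar_area"
  unfolding polar_area_def[abs_def] by (intro continuous_intros)

lemma has_derivative_polar_area:
  assumes "0 < v$1"
  shows "(polar_area has_derivative polar_area_deriv v) (at v within S)"
proof -
  have "((\<lambda>v. sqrt (2 * v$1)) has_derivative (\<lambda>h. h$1 / sqrt (2 * v$1))) (at v within S)"
    using assms by (auto intro!: derivative_eq_intros simp: field_simps)
  then have "(polar_area has_derivative
      (\<lambda>h. sqrt (2 * v$1) *\<^sub>R (h$2 *\<^sub>R dir_perp (v$2)) + (h$1 / sqrt (2 * v$1)) *\<^sub>R dir (v$2)))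
      (at v within S)"
    unfolding polar_area_def[abs_def]
    by (intro has_derivative_scaleR has_derivative_compose[OF has_derivative_vec_nth has_derivative_dir])
  then show ?thesis
    by (rule has_derivative_eq_rhs) (auto simp: polar_area_deriv_def algebra_simps fun_eq_iff)
qed

lemma det_polar_area_deriv:
  assumes "0 < v$1"
  shows "det (matrix (polar_area_deriv v)) = 1"
proof -
  have "0 < sqrt (2 * v$1)"
    using assms by simp
  moreover have "cos (v$2) * cos (v$2) + sin (v$2) * sin (v$2) = 1"
    by (rule sin_cos_squared_add3)
  ultimately show ?thesis
    by (simp add: det_2 matrix_def polar_area_deriv_def axis_def field_simps)
qed

lemma inj_on_polar_area: "inj_on polar_area polar_domain"
proof (rule inj_onI)
  fix v w
  assume "v \<in> polar_domain" "w \<in> polar_domain" "polar_area v = polar_area w"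
  then have "sqrt (2 * v$1) = sqrt (2 * w$1) \<and> v$2 = w$2"
    unfolding polar_area_def polar_domain_def by (subst (asm) scaleR_dir_eq_iff) auto
  then show "v = w"
    by (simp add: vec2_eq_iff)
qed

lemma polar_area_image: "polar_area ` polar_domain = - {0}"
proof
  show "polar_area ` polar_domain \<subseteq> - {0}"
    by (auto simp: polar_area_def polar_domain_def)
  show "- {0} \<subseteq> polar_area ` polar_domain"
  proof
    fix x :: "real^2"
    assume "x \<in> - {0}"
    then have "0 < norm x"
      by simp
    obtain t where t: "0 \<le> t" "t < 2*pi" "x = norm x *\<^sub>R dir t"
      by (rule polar_decomposition)
    have "polar_area (vector [(norm x)\<^sup>2 / 2, t]) = x"
      using \<open>0 < norm x\<close> by (simp add: polar_area_def t(3)[symmetric])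
    moreover have "vector [(norm x)\<^sup>2 / 2, t] \<in> polar_domain"
      using \<open>0 < norm x\<close> t(1,2) by (simp add: polar_domain_def)
    ultimately show "x \<in> polar_area ` polar_domain"
      by (metis image_eqI)
  qed
qed

lemma polar_area_preimage:
  assumes "A \<in> sets borel" "A \<in> lmeasurable"
  shows "polar_domain \<inter> polar_area -` A \<in> lmeasurable"
    and "measure lebesgue (polar_domain \<inter> polar_area -` A) = measure lebesgue A"
proof -
  let ?S = "polar_domain \<inter> polar_area -` A"
  have "polar_area \<in> borel_measurable borel"
    by (rule borel_measurable_continuous_onI[OF continuous_on_polar_area])
  then have "polar_area -` A \<in> sets borel"
    using assms(1) by (rule measurable_sets_borel)
  then have S: "?S \<in> sets lebesgue"
    using polar_domain_borel by simp
  have der: "\<And>v. v \<in> ?S \<Longrightarrow> (polar_area has_derivative polar_area_deriv v) (at v within ?S)"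
    by (rule has_derivative_polar_area) (simp add: polar_domain_def)
  have inj: "inj_on polar_area ?S"
    by (rule inj_on_subset[OF inj_on_polar_area]) blast
  have "polar_area ` ?S = polar_area ` polar_domain \<inter> A"
    by auto
  then have "polar_area ` ?S = A - {0}"
    by (auto simp: polar_area_image)
  moreover have "A - {0} \<in> lmeasurable"
    by (intro fmeasurable_Diff assms(2)) simp
  moreover have "measure lebesgue (A - {0}) = measure lebesgue A"
    using assms(2) negligible_sing[of 0] by (intro measure_Diff_null_set) (auto simp flip: negligible_iff_null_sets)
  ultimately have "polar_area ` ?S \<in> lmeasurable \<and> measure lebesgue (polar_area ` ?S) = measure lebesgue A"
    by simp
  then have "((\<lambda>v. \<bar>det (matrix (polar_area_deriv v))\<bar>) has_integral measure lebesgue A) ?S"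
    using has_measure_differentiable_image[OF S der inj] by blast
  then have "((\<lambda>v. 1) has_integral measure lebesgue A) ?S"
    by (rule has_integral_eq[rotated]) (simp add: det_polar_area_deriv polar_domain_def)
  then show "?S \<in> lmeasurable" "measure lebesgue ?S = measure lebesgue A"
    by (auto simp: has_integral_iff lmeasurable_iff_integrable_on lmeasure_integral)
qed

lemma continuous_absolutely_integrable_on_bounded:
  fixes f :: "'a::euclidean_space \<Rightarrow> real"
  assumes "continuous_on UNIV f" "S \<in> sets lebesgue" "bounded S"
  shows "f absolutely_integrable_on S"
proof -
  obtain a where "S \<subseteq> cbox (- a) a"
    using bounded_subset_cbox_symmetric[OF assms(3)] .
  moreover have "f absolutely_integrable_on cbox (- a) a"
    using assms(1) by (intro absolutely_integrable_continuous) (rule continuous_on_subset, auto)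
  ultimately show ?thesis
    using assms(2) set_integrable_subset by blast
qed

lemma integral_polar_image:
  fixes g :: "real^2 \<Rightarrow> real"
  assumes S: "S \<in> sets lebesgue" "S \<subseteq> polar_domain" and g: "g absolutely_integrable_on polar ` S"
  shows "integral (polar ` S) g = integral S (\<lambda>v. v$1 * g (polar v))"
proof -
  have der: "\<And>v. v \<in> S \<Longrightarrow> (polar has_derivative polar_deriv v) (at v within S)"
    by (rule has_derivative_polar)
  have inj: "inj_on polar S"
    using inj_on_polar S(2) by (rule inj_on_subset)
  have "(\<lambda>x. vec (g x) :: real^1) absolutely_integrable_on polar ` S"
    using g by (simp add: absolutely_integrable_on_1_iff)
  then have "integral (polar ` S) (\<lambda>x. vec (g x) :: real^1)
      = integral S (\<lambda>v. \<bar>det (matrix (polar_deriv v))\<bar> *\<^sub>R vec (g (polar v)))"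
    using integral_change_of_variables[OF S(1) der inj] by blast
  also have "\<dots> = integral S (\<lambda>v. vec (v$1 * g (polar v)))"
    using S(2) by (intro integral_cong) (auto simp: det_polar_deriv polar_domain_def vec_eq_iff)
  finally show ?thesis
    by (simp add: integral_on_1_eq vec_eq_iff)
qed

lemma integral_cball_polar:
  fixes g :: "real^2 \<Rightarrow> real"
  assumes "continuous_on UNIV g" "0 < r"
  shows "integral (cball 0 r) g
    = integral (cbox (vector [0, 0]) (vector [r, 2*pi])) (\<lambda>v. v$1 * g (polar v))"
proof -
  let ?S = "{v \<in> polar_domain. v$1 \<le> r}"
  have "polar ` ?S = polar ` polar_domain \<inter> cball 0 r"
    by (auto simp: norm_polar polar_domain_def)
  then have image: "polar ` ?S = cball 0 r - {0}"
    by (auto simp: polar_image)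
  have "integral (cball 0 r) g = integral (cball 0 r - {0}) g"
    by (rule integral_spike_set) (auto intro: negligible_subset[OF negligible_sing])
  also have "\<dots> = integral ?S (\<lambda>v. v$1 * g (polar v))"
    unfolding image[symmetric] using assms(1) image
    by (intro integral_polar_image continuous_absolutely_integrable_on_bounded)
       (auto simp: polar_domain_def)
  also have "\<dots> = integral (cbox (vector [0, 0]) (vector [r, 2*pi])) (\<lambda>v. v$1 * g (polar v))"
  proof (rule integral_spike_set)
    show "negligible {v \<in> ?S - cbox (vector [0, 0]) (vector [r, 2*pi]). v$1 * g (polar v) \<noteq> 0}"
      by (rule negligible_subset[OF negligible_empty]) (auto simp: polar_domain_def mem_box_cart forall_2)
    have "negligible ({v. v \<bullet> axis 1 1 = 0} \<union> {v::real^2. v \<bullet> axis 2 1 = 2*pi})"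
      by (intro negligible_Un negligible_standard_hyperplane) simp_all
    then show "negligible {v \<in> cbox (vector [0, 0]) (vector [r, 2*pi]) - ?S. v$1 * g (polar v) \<noteq> 0}"
      by (rule negligible_subset)
        (auto simp: polar_domain_def mem_box_cart forall_2 cart_eq_inner_axis[symmetric])
  qed
  finally show ?thesis .
qed

section \<open>Starshaped sets and their radial functions\<close>

lemma starshaped0_zero: "starshaped0 \<Omega> \<Longrightarrow> 0 \<in> \<Omega>"
  unfolding starshaped0_def using ends_in_segment(1) by blast

lemma starshaped0_scaleR:
  assumes "starshaped0 \<Omega>" "x \<in> \<Omega>" "0 \<le> c" "c \<le> 1"
  shows "c *\<^sub>R x \<in> \<Omega>"
proof -
  have "c *\<^sub>R x \<in> closed_segment 0 x"
    using assms(3,4) by (auto simp: closed_segment_def)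
  then show ?thesis
    using assms(1,2) unfolding starshaped0_def by blast
qed

lemma bdd_above_radial:
  assumes "compact \<Omega>"
  shows "bdd_above {l. 0 \<le> l \<and> l *\<^sub>R dir t \<in> \<Omega>}"
proof -
  obtain R where R: "\<And>x. x \<in> \<Omega> \<Longrightarrow> norm x \<le> R"
    using compact_imp_bounded[OF assms] bounded_iff by blast
  show ?thesis
    by (rule bdd_aboveI[of _ R]) (auto dest: R)
qed

lemma radial_fun_mem:
  assumes "compact \<Omega>" "starshaped0 \<Omega>"
  shows "0 \<le> radial_fun \<Omega> t" "radial_fun \<Omega> t *\<^sub>R dir t \<in> \<Omega>"
proof -
  let ?A = "{l. 0 \<le> l \<and> l *\<^sub>R dir t \<in> \<Omega>}"
  have "continuous_on UNIV (\<lambda>l::real. l *\<^sub>R dir t)"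
    by (intro continuous_intros)
  then have "closed ((\<lambda>l. l *\<^sub>R dir t) -` \<Omega>)"
    using closed_vimage compact_imp_closed[OF assms(1)] by blast
  moreover have "?A = {0..} \<inter> (\<lambda>l. l *\<^sub>R dir t) -` \<Omega>"
    by auto
  ultimately have "closed ?A"
    by (metis closed_Int closed_atLeast)
  moreover have "0 \<in> ?A"
    using starshaped0_zero[OF assms(2)] by simp
  ultimately have "Sup ?A \<in> ?A"
    using closed_contains_Sup[OF _ bdd_above_radial[OF assms(1)]] by blast
  then show "0 \<le> radial_fun \<Omega> t" "radial_fun \<Omega> t *\<^sub>R dir t \<in> \<Omega>"
    unfolding radial_fun_def by auto
qed

lemma radial_fun_bounded:
  assumes "compact \<Omega>" "starshaped0 \<Omega>"
  obtains R where "\<And>t. \<bar>radial_fun \<Omega> t\<bar> \<le> R"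
proof -
  obtain R where R: "\<And>x. x \<in> \<Omega> \<Longrightarrow> norm x \<le> R"
    using compact_imp_bounded[OF assms(1)] bounded_iff by blast
  have "\<bar>radial_fun \<Omega> t\<bar> \<le> R" for t
    using R[OF radial_fun_mem(2)[OF assms, of t]] radial_fun_mem(1)[OF assms, of t] by simp
  then show ?thesis
    by (rule that)
qed

lemma scaleR_dir_mem_iff:
  assumes "compact \<Omega>" "starshaped0 \<Omega>" "0 \<le> l"
  shows "l *\<^sub>R dir t \<in> \<Omega> \<longleftrightarrow> l \<le> radial_fun \<Omega> t"
proof
  show "l *\<^sub>R dir t \<in> \<Omega> \<Longrightarrow> l \<le> radial_fun \<Omega> t"
    unfolding radial_fun_def using assms(3) bdd_above_radial[OF assms(1)] by (auto intro: cSup_upper)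
next
  assume le: "l \<le> radial_fun \<Omega> t"
  show "l *\<^sub>R dir t \<in> \<Omega>"
  proof (cases "radial_fun \<Omega> t = 0")
    case True
    then show ?thesis
      using le assms(3) starshaped0_zero[OF assms(2)] by simp
  next
    case False
    then have pos: "0 < radial_fun \<Omega> t"
      using radial_fun_mem(1)[OF assms(1,2), of t] by linarith
    have "(l / radial_fun \<Omega> t) *\<^sub>R (radial_fun \<Omega> t *\<^sub>R dir t) \<in> \<Omega>"
      by (rule starshaped0_scaleR[OF assms(2) radial_fun_mem(2)[OF assms(1,2)]])
        (use pos le assms(3) in auto)
    then show ?thesis
      using pos by simp
  qed
qed

lemma mem_starshaped_iff:
  assumes "compact \<Omega>" "starshaped0 \<Omega>" "x = norm x *\<^sub>R dir t"
  shows "x \<in> \<Omega> \<longleftrightarrow> norm x \<le> radial_fun \<Omega> t"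
  using scaleR_dir_mem_iff[OF assms(1,2) norm_ge_zero, of x t] by (simp only: assms(3)[symmetric])

lemma cball_subset_starshaped:
  assumes "compact \<Omega>" "starshaped0 \<Omega>" "\<forall>\<theta>\<in>{0..<2*pi}. r \<le> radial_fun \<Omega> \<theta>"
  shows "cball 0 r \<subseteq> \<Omega>"
proof
  fix x :: "real^2"
  assume "x \<in> cball 0 r"
  then have "norm x \<le> r"
    by simp
  obtain t where t01: "0 \<le> t" "t < 2*pi" and t: "x = norm x *\<^sub>R dir t"
    by (rule polar_decomposition)
  have "r \<le> radial_fun \<Omega> t"
    using assms(3) t01 by simp
  with \<open>norm x \<le> r\<close> show "x \<in> \<Omega>"
    using mem_starshaped_iff[OF assms(1,2) t] by simp
qed

lemma starshaped_subset_scaleR: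
  assumes "compact \<Omega>1" "starshaped0 \<Omega>1" "compact \<Omega>2" "starshaped0 \<Omega>2"
    and "0 < r" "0 \<le> \<epsilon>"
    and "\<And>\<theta>. 0 \<le> \<theta> \<Longrightarrow> \<theta> < 2*pi \<Longrightarrow> r \<le> radial_fun \<Omega>2 \<theta>"
    and "\<And>\<theta>. 0 \<le> \<theta> \<Longrightarrow> \<theta> < 2*pi \<Longrightarrow> radial_fun \<Omega>1 \<theta> \<le> radial_fun \<Omega>2 \<theta> + \<epsilon>"
  shows "\<Omega>1 \<subseteq> (*\<^sub>R) (1 + \<epsilon> / r) ` \<Omega>2"
proof
  fix x :: "real^2"
  assume x: "x \<in> \<Omega>1"
  let ?c = "1 + \<epsilon> / r"
  have c: "0 < ?c"
    using assms(5,6) by (simp add: add_pos_nonneg)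
  obtain t where t: "0 \<le> t" "t < 2*pi" "x = norm x *\<^sub>R dir t"
    by (rule polar_decomposition)
  have "\<epsilon> \<le> \<epsilon> / r * radial_fun \<Omega>2 t"
    using mult_left_mono[OF assms(7)[OF t(1,2)], of "\<epsilon> / r"] assms(5,6) by simp
  then have "norm x \<le> ?c * radial_fun \<Omega>2 t"
    using mem_starshaped_iff[OF assms(1,2) t(3)] x assms(8)[OF t(1,2)] by (simp add: algebra_simps)
  then have "norm x / ?c \<le> radial_fun \<Omega>2 t"
    using c by (simp add: pos_divide_le_eq mult.commute)
  then have "(norm x / ?c) *\<^sub>R dir t \<in> \<Omega>2"
    using c by (simp add: scaleR_dir_mem_iff[OF assms(3,4)])
  moreover have "x = ?c *\<^sub>R ((norm x / ?c) *\<^sub>R dir t)"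
    using c by (simp add: t(3)[symmetric])
  ultimately show "x \<in> (*\<^sub>R) ?c ` \<Omega>2"
    by blast
qed

lemma abs_le_sup_norm:
  assumes "\<And>t. \<bar>f t\<bar> \<le> B" "0 \<le> t" "t < 2*pi"
  shows "\<bar>f t\<bar> \<le> sup_norm f"
  unfolding sup_norm_def using assms by (intro cSUP_upper bdd_aboveI2) auto

lemma radial_fun_le_sup_norm:
  assumes "compact \<Omega>" "starshaped0 \<Omega>" "0 \<le> t" "t < 2*pi"
  shows "radial_fun \<Omega> t \<le> sup_norm (radial_fun \<Omega>)"
proof -
  obtain R where "\<And>t. \<bar>radial_fun \<Omega> t\<bar> \<le> R"
    using radial_fun_bounded[OF assms(1,2)] by blast
  then have "\<bar>radial_fun \<Omega> t\<bar> \<le> sup_norm (radial_fun \<Omega>)"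
    by (rule abs_le_sup_norm[OF _ assms(3,4)])
  then show ?thesis
    by simp
qed

lemma radial_fun_diff_le_sup_norm:
  assumes "compact \<Omega>1" "starshaped0 \<Omega>1" "compact \<Omega>2" "starshaped0 \<Omega>2"
    and "0 \<le> t" "t < 2*pi"
  shows "\<bar>radial_fun \<Omega>1 t - radial_fun \<Omega>2 t\<bar> \<le> sup_norm (\<lambda>\<theta>. radial_fun \<Omega>1 \<theta> - radial_fun \<Omega>2 \<theta>)"
proof -
  obtain R1 where R1: "\<And>t. \<bar>radial_fun \<Omega>1 t\<bar> \<le> R1"
    using radial_fun_bounded[OF assms(1,2)] by blast
  obtain R2 where R2: "\<And>t. \<bar>radial_fun \<Omega>2 t\<bar> \<le> R2"
    using radial_fun_bounded[OF assms(3,4)] by blast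
  have "\<bar>radial_fun \<Omega>1 t - radial_fun \<Omega>2 t\<bar> \<le> R1 + R2" for t
    using abs_triangle_ineq4[of "radial_fun \<Omega>1 t" "radial_fun \<Omega>2 t"] R1[of t] R2[of t] by linarith
  then show ?thesis
    by (rule abs_le_sup_norm[where f = "\<lambda>\<theta>. radial_fun \<Omega>1 \<theta> - radial_fun \<Omega>2 \<theta>", OF _ assms(5,6)])
qed

section \<open>Area\<close>

lemma measure_starshaped_polar_area:
  assumes "compact \<Omega>" "starshaped0 \<Omega>"
  defines "T \<equiv> {v \<in> polar_domain. v$1 \<le> (radial_fun \<Omega> (v$2))\<^sup>2 / 2}"
  shows "T \<in> lmeasurable" "measure lebesgue T = measure lebesgue \<Omega>"
proof -
  have "polar_area v \<in> \<Omega> \<longleftrightarrow> v$1 \<le> (radial_fun \<Omega> (v$2))\<^sup>2 / 2" if "v \<in> polar_domain" for v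
  proof -
    have "polar_area v \<in> \<Omega> \<longleftrightarrow> sqrt (2 * v$1) \<le> radial_fun \<Omega> (v$2)"
      unfolding polar_area_def using that by (intro scaleR_dir_mem_iff[OF assms(1,2)]) (simp add: polar_domain_def)
    also have "\<dots> \<longleftrightarrow> 2 * v$1 \<le> (radial_fun \<Omega> (v$2))\<^sup>2"
      using that radial_fun_mem(1)[OF assms(1,2)] by (simp add: real_sqrt_le_iff' polar_domain_def)
    finally show ?thesis
      by linarith
  qed
  then have "T = polar_domain \<inter> polar_area -` \<Omega>"
    unfolding T_def by auto
  then show "T \<in> lmeasurable" "measure lebesgue T = measure lebesgue \<Omega>"
    using assms(1) by (auto intro: polar_area_preimage borel_compact lmeasurable_compact)
qed

lemma mem_translate_axis1:
  "(x::real^2) \<in> (+) (a *\<^sub>R axis 1 1) ` U \<longleftrightarrow> (\<exists>u\<in>U. x$1 = u$1 + a \<and> x$2 = u$2)"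
  by (force simp: vec2_eq_iff axis_def)

text \<open>A measurable set lying between the graphs of \<open>F\<close> and \<open>F + \<delta>\<close> over \<open>[0, c]\<close> has measure
  at most \<open>c \<delta>\<close>: its translates by \<open>k \<delta>\<close>, \<open>k < N\<close>, in the first coordinate are pairwise
  disjoint and fit into a box of area \<open>c (N \<delta> + O(1))\<close>. No measurability of \<open>F\<close> is needed.\<close>

lemma disjnt_translates_thin_strip:
  fixes U :: "(real^2) set"
  assumes "0 \<le> \<delta>" "k < j" and strip: "\<And>v. v \<in> U \<Longrightarrow> F (v$2) < v$1 \<and> v$1 \<le> F (v$2) + \<delta>"
  shows "disjnt ((+) ((real k * \<delta>) *\<^sub>R axis 1 1) ` U) ((+) ((real j * \<delta>) *\<^sub>R axis 1 1) ` U)"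
proof -
  have "real k * \<delta> + \<delta> \<le> real j * \<delta>"
    using assms(1,2) mult_right_mono[of "real k + 1" "real j" \<delta>] by (simp add: algebra_simps)
  then have False
    if "u \<in> U" "w \<in> U" "u$1 + real k * \<delta> = w$1 + real j * \<delta>" "u$2 = w$2" for u w :: "real^2"
    using strip[OF that(1)] strip[OF that(2)] that(3,4) by auto
  then show ?thesis
    unfolding disjnt_iff mem_translate_axis1 by force
qed

lemma measure_translates_thin_strip:
  fixes U :: "(real^2) set" and F :: "real \<Rightarrow> real"
  assumes U: "U \<in> lmeasurable" and "0 \<le> \<delta>" "0 \<le> c" and F: "\<And>s. \<bar>F s\<bar> \<le> B"
    and strip: "\<And>v. v \<in> U \<Longrightarrow> 0 \<le> v$2 \<and> v$2 \<le> c \<and> F (v$2) < v$1 \<and> v$1 \<le> F (v$2) + \<delta>"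
  shows "real N * measure lebesgue U \<le> c * (2 * B + real (Suc N) * \<delta>)"
proof -
  define V where "V k = (+) ((real k * \<delta>) *\<^sub>R axis 1 1) ` U" for k :: nat
  have Vm: "V k \<in> lmeasurable" for k
    unfolding V_def by (rule measurable_translation[OF U])
  have "pairwise (\<lambda>k j. disjnt (V k) (V j)) {..<N}"
    unfolding pairwise_def V_def
    by (metis disjnt_sym nat_neq_iff disjnt_translates_thin_strip[OF \<open>0 \<le> \<delta>\<close>] strip)
  then have "measure lebesgue (\<Union>k<N. V k) = (\<Sum>k<N. measure lebesgue (V k))"
    using Vm by (intro measure_UNION') auto
  also have "\<dots> = real N * measure lebesgue U"
    by (simp add: V_def measure_translation)
  finally have "real N * measure lebesgue U = measure lebesgue (\<Union>k<N. V k)" ..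
  also have "\<dots> \<le> measure lebesgue (cbox (vector [- B, 0]) (vector [B + real (Suc N) * \<delta>, c]) :: (real^2) set)"
  proof (rule measure_mono_fmeasurable)
    show "(\<Union>k<N. V k) \<subseteq> cbox (vector [- B, 0]) (vector [B + real (Suc N) * \<delta>, c])"
    proof
      fix x
      assume "x \<in> (\<Union>k<N. V k)"
      then obtain k u where "k < N" "u \<in> U" "x$1 = u$1 + real k * \<delta>" "x$2 = u$2"
        by (auto simp: V_def mem_translate_axis1)
      moreover have "0 \<le> real k * \<delta>" "real k * \<delta> \<le> real N * \<delta>"
        using \<open>k < N\<close> \<open>0 \<le> \<delta>\<close> by (simp_all add: mult_right_mono)
      moreover note strip[OF \<open>u \<in> U\<close>] F[of "u$2", unfolded abs_le_iff]
      ultimately have "- B \<le> x$1" "x$1 \<le> B + \<delta> + real N * \<delta>" "0 \<le> x$2" "x$2 \<le> c"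
        by linarith+
      then show "x \<in> cbox (vector [- B, 0]) (vector [B + real (Suc N) * \<delta>, c])"
        by (simp add: mem_box_cart forall_2 algebra_simps)
    qed
    show "(\<Union>k<N. V k) \<in> sets lebesgue"
      using Vm by (intro sets.finite_UN) auto
  qed simp
  also have "\<dots> = c * (2 * B + real (Suc N) * \<delta>)"
    using \<open>0 \<le> \<delta>\<close> \<open>0 \<le> c\<close> F[of 0] by (subst measure_cbox_vec2) (auto simp: algebra_simps)
  finally show ?thesis .
qed

lemma measure_thin_strip:
  fixes U :: "(real^2) set" and F :: "real \<Rightarrow> real"
  assumes "U \<in> lmeasurable" "0 \<le> \<delta>" "0 \<le> c" "\<And>s. \<bar>F s\<bar> \<le> B"
    and "\<And>v. v \<in> U \<Longrightarrow> 0 \<le> v$2 \<and> v$2 \<le> c \<and> F (v$2) < v$1 \<and> v$1 \<le> F (v$2) + \<delta>"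
  shows "measure lebesgue U \<le> c * \<delta>"
proof (rule ccontr)
  assume "\<not> ?thesis"
  then have pos: "0 < measure lebesgue U - c * \<delta>"
    by simp
  obtain N :: nat where "c * (2 * B + \<delta>) / (measure lebesgue U - c * \<delta>) < real N"
    using reals_Archimedean2 by blast
  then have "c * (2 * B + \<delta>) < real N * (measure lebesgue U - c * \<delta>)"
    using pos by (simp add: divide_less_eq mult.commute)
  moreover have "real N * measure lebesgue U \<le> c * (2 * B + real (Suc N) * \<delta>)"
    by (rule measure_translates_thin_strip[OF assms])
  ultimately show False
    by (simp add: algebra_simps)
qed

lemma square_le_square_add:
  fixes a b M \<epsilon> :: real
  assumes "0 \<le> a" "0 \<le> b" "a \<le> M" "b \<le> M" "0 \<le> \<epsilon>" "a \<le> b + \<epsilon>"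
  shows "a\<^sup>2 \<le> b\<^sup>2 + 2 * M * \<epsilon>"
proof (cases "a \<le> b")
  case True
  then have "a\<^sup>2 \<le> b\<^sup>2"
    using assms(1) by (rule power_mono)
  moreover have "0 \<le> 2 * M * \<epsilon>"
    using assms by simp
  ultimately show ?thesis
    by linarith
next
  case False
  have "a\<^sup>2 - b\<^sup>2 = (a - b) * (a + b)"
    by (simp add: power2_eq_square algebra_simps)
  also have "\<dots> \<le> \<epsilon> * (2 * M)"
    using False assms by (intro mult_mono) auto
  finally show ?thesis
    by (simp add: algebra_simps)
qed

lemma measure_starshaped_le:
  assumes "compact \<Omega>1" "starshaped0 \<Omega>1" "compact \<Omega>2" "starshaped0 \<Omega>2" "0 \<le> \<epsilon>"
    and M: "\<And>t. 0 \<le> t \<Longrightarrow> t < 2*pi \<Longrightarrow> radial_fun \<Omega>1 t \<le> M \<and> radial_fun \<Omega>2 t \<le> M"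
    and \<epsilon>: "\<And>t. 0 \<le> t \<Longrightarrow> t < 2*pi \<Longrightarrow> radial_fun \<Omega>1 t \<le> radial_fun \<Omega>2 t + \<epsilon>"
  shows "measure lebesgue \<Omega>1 \<le> measure lebesgue \<Omega>2 + 2 * pi * M * \<epsilon>"
proof -
  let ?f1 = "radial_fun \<Omega>1" and ?f2 = "radial_fun \<Omega>2"
  let ?T1 = "{v \<in> polar_domain. v$1 \<le> (?f1 (v$2))\<^sup>2 / 2}"
  let ?T2 = "{v \<in> polar_domain. v$1 \<le> (?f2 (v$2))\<^sup>2 / 2}"
  note T1 = measure_starshaped_polar_area[OF assms(1,2)]
  note T2 = measure_starshaped_polar_area[OF assms(3,4)]
  obtain B where B: "\<And>t. \<bar>?f2 t\<bar> \<le> B"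
    using radial_fun_bounded[OF assms(3,4)] by blast
  have "0 \<le> M"
    using M[of 0] radial_fun_mem(1)[OF assms(1,2), of 0] by simp
  have "measure lebesgue (?T1 - ?T2) \<le> 2 * pi * (M * \<epsilon>)"
  proof (rule measure_thin_strip[where F = "\<lambda>s. (?f2 s)\<^sup>2 / 2" and B = "B\<^sup>2 / 2"])
    show "?T1 - ?T2 \<in> lmeasurable"
      using T1(1) T2(1) by blast
    show "0 \<le> M * \<epsilon>" "0 \<le> 2 * pi"
      using \<open>0 \<le> M\<close> assms(5) by simp_all
    show "\<bar>(?f2 s)\<^sup>2 / 2\<bar> \<le> B\<^sup>2 / 2" for s
      using power_mono[OF B[of s] abs_ge_zero, of 2] by simp
    fix v
    assume v: "v \<in> ?T1 - ?T2"
    then have t: "0 \<le> v$2" "v$2 < 2*pi"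
      by (auto simp: polar_domain_def)
    have "(?f1 (v$2))\<^sup>2 \<le> (?f2 (v$2))\<^sup>2 + 2 * M * \<epsilon>"
      using radial_fun_mem(1)[OF assms(1,2)] radial_fun_mem(1)[OF assms(3,4)] M[OF t] \<epsilon>[OF t] assms(5)
      by (intro square_le_square_add) auto
    then show "0 \<le> v$2 \<and> v$2 \<le> 2*pi \<and> (?f2 (v$2))\<^sup>2 / 2 < v$1 \<and> v$1 \<le> (?f2 (v$2))\<^sup>2 / 2 + M * \<epsilon>"
      using v t by auto
  qed
  moreover have "measure lebesgue ?T1 - measure lebesgue ?T2 \<le> measure lebesgue (?T1 - ?T2)"
    using T1(1) T2(1) by (rule measure_diff_le_measure_setdiff)
  ultimately show ?thesis
    using T1(2) T2(2) by (simp add: algebra_simps)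
qed

lemma measure_starshaped_diff_le:
  assumes "compact \<Omega>1" "starshaped0 \<Omega>1" "compact \<Omega>2" "starshaped0 \<Omega>2"
  shows "\<bar>measure lebesgue \<Omega>1 - measure lebesgue \<Omega>2\<bar>
           \<le> 2 * pi * max (sup_norm (radial_fun \<Omega>1)) (sup_norm (radial_fun \<Omega>2))
               * sup_norm (\<lambda>\<theta>. radial_fun \<Omega>1 \<theta> - radial_fun \<Omega>2 \<theta>)"
proof -
  let ?M = "max (sup_norm (radial_fun \<Omega>1)) (sup_norm (radial_fun \<Omega>2))"
  let ?\<epsilon> = "sup_norm (\<lambda>\<theta>. radial_fun \<Omega>1 \<theta> - radial_fun \<Omega>2 \<theta>)"
  have M: "radial_fun \<Omega>1 t \<le> ?M \<and> radial_fun \<Omega>2 t \<le> ?M" if "0 \<le> t" "t < 2*pi" for t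
    using radial_fun_le_sup_norm[OF assms(1,2) that] radial_fun_le_sup_norm[OF assms(3,4) that] by auto
  have \<epsilon>: "\<bar>radial_fun \<Omega>1 t - radial_fun \<Omega>2 t\<bar> \<le> ?\<epsilon>" if "0 \<le> t" "t < 2*pi" for t
    using radial_fun_diff_le_sup_norm[OF assms that] .
  have "\<bar>radial_fun \<Omega>1 0 - radial_fun \<Omega>2 0\<bar> \<le> ?\<epsilon>"
    by (rule \<epsilon>) simp_all
  then have "0 \<le> ?\<epsilon>"
    by (rule order_trans[OF abs_ge_zero])
  have "measure lebesgue \<Omega>1 \<le> measure lebesgue \<Omega>2 + 2 * pi * ?M * ?\<epsilon>"
  proof (rule measure_starshaped_le[OF assms \<open>0 \<le> ?\<epsilon>\<close>])
    show "radial_fun \<Omega>1 t \<le> radial_fun \<Omega>2 t + ?\<epsilon>" if "0 \<le> t" "t < 2*pi" for t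
      using \<epsilon>[OF that] by linarith
  qed (use M in blast)
  moreover have "measure lebesgue \<Omega>2 \<le> measure lebesgue \<Omega>1 + 2 * pi * ?M * ?\<epsilon>"
  proof (rule measure_starshaped_le[OF assms(3,4,1,2) \<open>0 \<le> ?\<epsilon>\<close>])
    show "radial_fun \<Omega>2 t \<le> radial_fun \<Omega>1 t + ?\<epsilon>" if "0 \<le> t" "t < 2*pi" for t
      using \<epsilon>[OF that] by linarith
  qed (use M in blast)
  ultimately show ?thesis
    by linarith
qed

section \<open>The divergence theorem on a disc\<close>

lemma continuous_on_matrix_vector_mult [continuous_intros]:
  fixes A :: "'a::topological_space \<Rightarrow> real^'n^'m"
  assumes "continuous_on S A" "continuous_on S v"
  shows "continuous_on S (\<lambda>x. A x *v v x)"
  unfolding matrix_vector_mult_def by (intro continuous_intros assms)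

lemma divergence_eq_trace: "divergence \<phi> x = trace (jacobian \<phi> (at x))"
  by (simp add: divergence_def jacobian_def trace_def matrix_def)

lemma continuous_on_jacobian_iff:
  "continuous_on UNIV (\<lambda>x. jacobian \<phi> (at x)) \<longleftrightarrow>
     (\<forall>i j. continuous_on UNIV (\<lambda>x. frechet_derivative \<phi> (at x) (axis i 1) $ j))"
proof
  assume "continuous_on UNIV (\<lambda>x. jacobian \<phi> (at x))"
  then have "continuous_on UNIV (\<lambda>x. jacobian \<phi> (at x) $ j $ i)" for i j
    by (intro continuous_intros)
  then show "\<forall>i j. continuous_on UNIV (\<lambda>x. frechet_derivative \<phi> (at x) (axis i 1) $ j)"
    by (simp add: jacobian_def matrix_def)
next
  assume "\<forall>i j. continuous_on UNIV (\<lambda>x. frechet_derivative \<phi> (at x) (axis i 1) $ j)"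
  then show "continuous_on UNIV (\<lambda>x. jacobian \<phi> (at x))"
    unfolding jacobian_def matrix_def by (intro continuous_on_vec_lambda) simp
qed

lemma test_field_iff:
  "test_field \<phi> \<longleftrightarrow>
     (\<forall>x. \<phi> differentiable (at x)) \<and> continuous_on UNIV (\<lambda>x. jacobian \<phi> (at x)) \<and>
     compact (closure {x. \<phi> x \<noteq> 0}) \<and> (\<forall>x. norm (\<phi> x) \<le> 1)"
  unfolding test_field_def continuous_on_jacobian_iff ..

lemma continuous_on_jacobian: "test_field \<phi> \<Longrightarrow> continuous_on UNIV (\<lambda>x. jacobian \<phi> (at x))"
  by (simp add: test_field_iff)

lemma test_field_has_derivative:
  assumes "test_field \<phi>"
  shows "(\<phi> has_derivative (\<lambda>h. jacobian \<phi> (at x) *v h)) (at x within S)"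
  using assms by (simp add: test_field_def jacobian_works has_derivative_at_withinI)

lemma test_field_continuous: "test_field \<phi> \<Longrightarrow> continuous_on UNIV \<phi>"
  by (meson has_derivative_continuous_on test_field_has_derivative)

lemma continuous_on_test_field_compose:
  "test_field \<phi> \<Longrightarrow> continuous_on S f \<Longrightarrow> continuous_on S (\<lambda>x. \<phi> (f x))"
  by (rule continuous_on_compose2[OF test_field_continuous]) auto

lemma continuous_on_jacobian_compose [continuous_intros]:
  "test_field \<phi> \<Longrightarrow> continuous_on S f \<Longrightarrow> continuous_on S (\<lambda>x. jacobian \<phi> (at (f x)))"
  by (rule continuous_on_compose2[OF continuous_on_jacobian]) auto

lemma continuous_on_divergence: "test_field \<phi> \<Longrightarrow> continuous_on UNIV (divergence \<phi>)"
  unfolding divergence_eq_trace[abs_def] trace_def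
  by (intro continuous_intros continuous_on_jacobian)

text \<open>In polar coordinates \<open>\<rho> div \<phi> (\<rho> e) = d/d\<rho> (\<rho> \<phi>\<cdot>e) + d/d\<theta> (\<phi>\<cdot>e')\<close> with
  \<open>e = dir \<theta>\<close> and \<open>e' = dir_perp \<theta>\<close>, because the trace of the Jacobian can be computed in the
  rotated frame \<open>(e, e')\<close>. Over the rectangle \<open>[0, r] \<times> [0, 2\<pi>]\<close> the angular term integrates to
  zero by periodicity and the radial one to \<open>r \<phi>\<cdot>e \<le> r\<close>.\<close>

lemma trace_eq_polar_frame:
  fixes A :: "real^2^2"
  shows "(A *v dir t) \<bullet> dir t + (A *v dir_perp t) \<bullet> dir_perp t = trace A"
proof -
  have cs: "a * (cos t * cos t) + a * (sin t * sin t) = a" for a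
    by (metis distrib_left mult_1_right sin_cos_squared_add3)
  show ?thesis
    using cs[of "A$1$1"] cs[of "A$2$2"]
    by (simp add: inner_vec_def matrix_vector_mult_def sum_2 trace_def algebra_simps)
qed

lemma has_real_derivative_radial_flux:
  assumes "test_field \<phi>"
  shows "((\<lambda>\<rho>. \<rho> * (\<phi> (\<rho> *\<^sub>R dir \<theta>) \<bullet> dir \<theta>)) has_real_derivative
      \<phi> (\<rho> *\<^sub>R dir \<theta>) \<bullet> dir \<theta> + \<rho> * ((jacobian \<phi> (at (\<rho> *\<^sub>R dir \<theta>)) *v dir \<theta>) \<bullet> dir \<theta>))
    (at \<rho> within S)"
proof -
  let ?J = "jacobian \<phi> (at (\<rho> *\<^sub>R dir \<theta>))"
  have "((\<lambda>\<rho>::real. \<rho> *\<^sub>R dir \<theta>) has_derivative (\<lambda>h. h *\<^sub>R dir \<theta>)) (at \<rho> within S)"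
    by (intro derivative_eq_intros) auto
  then have "((\<lambda>\<rho>. \<phi> (\<rho> *\<^sub>R dir \<theta>)) has_derivative (\<lambda>h. ?J *v (h *\<^sub>R dir \<theta>))) (at \<rho> within S)"
    using has_derivative_compose test_field_has_derivative[OF assms] by blast
  then have "((\<lambda>\<rho>. \<rho> * (\<phi> (\<rho> *\<^sub>R dir \<theta>) \<bullet> dir \<theta>)) has_derivative
      (\<lambda>h. \<rho> * ((?J *v (h *\<^sub>R dir \<theta>)) \<bullet> dir \<theta>) + h * (\<phi> (\<rho> *\<^sub>R dir \<theta>) \<bullet> dir \<theta>))) (at \<rho> within S)"
    by (intro derivative_eq_intros) auto
  then show ?thesis
    unfolding has_field_derivative_def
    by (rule has_derivative_eq_rhs) (simp add: fun_eq_iff matrix_scaleR_vector_ac scaleR_matrix_vector_assoc[symmetric] algebra_simps)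
qed

lemma has_real_derivative_angular_flux:
  assumes "test_field \<phi>"
  shows "((\<lambda>\<theta>. \<phi> (\<rho> *\<^sub>R dir \<theta>) \<bullet> dir_perp \<theta>) has_real_derivative
      \<rho> * ((jacobian \<phi> (at (\<rho> *\<^sub>R dir \<theta>)) *v dir_perp \<theta>) \<bullet> dir_perp \<theta>) - \<phi> (\<rho> *\<^sub>R dir \<theta>) \<bullet> dir \<theta>)
    (at \<theta> within S)"
proof -
  let ?J = "jacobian \<phi> (at (\<rho> *\<^sub>R dir \<theta>))"
  have "((\<lambda>\<theta>. \<rho> *\<^sub>R dir \<theta>) has_derivative (\<lambda>h. \<rho> *\<^sub>R (h *\<^sub>R dir_perp \<theta>))) (at \<theta> within S)"
    by (intro derivative_eq_intros) auto
  then have "((\<lambda>\<theta>. \<phi> (\<rho> *\<^sub>R dir \<theta>)) has_derivative (\<lambda>h. ?J *v (\<rho> *\<^sub>R (h *\<^sub>R dir_perp \<theta>)))) (at \<theta> within S)"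
    using has_derivative_compose test_field_has_derivative[OF assms] by blast
  then have "((\<lambda>\<theta>. \<phi> (\<rho> *\<^sub>R dir \<theta>) \<bullet> dir_perp \<theta>) has_derivative
      (\<lambda>h. \<phi> (\<rho> *\<^sub>R dir \<theta>) \<bullet> (- h *\<^sub>R dir \<theta>) + (?J *v (\<rho> *\<^sub>R (h *\<^sub>R dir_perp \<theta>))) \<bullet> dir_perp \<theta>))
      (at \<theta> within S)"
    by (intro derivative_eq_intros) auto
  then show ?thesis
    unfolding has_field_derivative_def
    by (rule has_derivative_eq_rhs) (simp add: fun_eq_iff matrix_scaleR_vector_ac scaleR_matrix_vector_assoc[symmetric] algebra_simps)
qed

lemma has_integral_angular_flux_derivative:
  assumes "test_field \<phi>"
  shows "((\<lambda>(\<rho>, \<theta>). \<rho> * ((jacobian \<phi> (at (\<rho> *\<^sub>R dir \<theta>)) *v dir_perp \<theta>) \<bullet> dir_perp \<theta>)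
      - \<phi> (\<rho> *\<^sub>R dir \<theta>) \<bullet> dir \<theta>) has_integral 0) (cbox (0, 0) (r, 2*pi))"
    (is "(?F has_integral 0) _")
proof -
  have cont: "continuous_on (cbox (0, 0) (r, 2*pi)) ?F"
    unfolding case_prod_beta'
    by (intro continuous_intros continuous_on_test_field_compose[OF assms] assms)
  then have "integral (cbox (0, 0) (r, 2*pi)) ?F = integral (cbox 0 r) (\<lambda>\<rho>. integral (cbox 0 (2*pi)) (\<lambda>\<theta>. ?F (\<rho>, \<theta>)))"
    by (rule integral_prod_continuous)
  also have "\<dots> = integral (cbox 0 r) (\<lambda>\<rho>. 0)"
  proof (rule integral_cong)
    fix \<rho>
    have "((\<lambda>\<theta>. ?F (\<rho>, \<theta>)) has_integral
        \<phi> (\<rho> *\<^sub>R dir (2*pi)) \<bullet> dir_perp (2*pi) - \<phi> (\<rho> *\<^sub>R dir 0) \<bullet> dir_perp 0) {0..2*pi}"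
      by (intro fundamental_theorem_of_calculus)
         (auto simp: has_real_derivative_iff_has_vector_derivative[symmetric]
           intro: has_real_derivative_angular_flux[OF assms])
    then show "integral (cbox 0 (2*pi)) (\<lambda>\<theta>. ?F (\<rho>, \<theta>)) = 0"
      by (simp add: integral_unique dir_def dir_perp_def)
  qed
  finally show ?thesis
    using integrable_continuous[OF cont] by (simp add: has_integral_iff)
qed

lemma radial_flux_le:
  assumes "test_field \<phi>" "0 \<le> r"
  shows "r * (\<phi> (r *\<^sub>R dir \<theta>) \<bullet> dir \<theta>) \<le> r"
proof -
  have "\<phi> (r *\<^sub>R dir \<theta>) \<bullet> dir \<theta> \<le> norm (\<phi> (r *\<^sub>R dir \<theta>)) * norm (dir \<theta>)"
    by (rule norm_cauchy_schwarz)
  also have "\<dots> \<le> 1"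
    using assms(1) by (simp add: test_field_def)
  finally show ?thesis
    using mult_left_mono[OF _ assms(2)] by fastforce
qed

lemma integral_radial_flux_derivative_le:
  assumes "test_field \<phi>" "0 \<le> r"
  defines "F \<equiv> \<lambda>(\<rho>, \<theta>).
      \<phi> (\<rho> *\<^sub>R dir \<theta>) \<bullet> dir \<theta> + \<rho> * ((jacobian \<phi> (at (\<rho> *\<^sub>R dir \<theta>)) *v dir \<theta>) \<bullet> dir \<theta>)"
  shows "F integrable_on cbox (0, 0) (r, 2*pi)" "integral (cbox (0, 0) (r, 2*pi)) F \<le> 2*pi*r"
proof -
  have cont: "continuous_on (cbox (0, 0) (r, 2*pi)) F"
    unfolding F_def case_prod_beta'
    by (intro continuous_intros continuous_on_test_field_compose[OF assms(1)] assms(1))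
  then show "F integrable_on cbox (0, 0) (r, 2*pi)"
    by (rule integrable_continuous)
  have "integral (cbox (0, 0) (r, 2*pi)) F = integral (cbox 0 r) (\<lambda>\<rho>. integral (cbox 0 (2*pi)) (\<lambda>\<theta>. F (\<rho>, \<theta>)))"
    using cont by (rule integral_prod_continuous)
  also have "\<dots> = integral (cbox 0 (2*pi)) (\<lambda>\<theta>. integral (cbox 0 r) (\<lambda>\<rho>. F (\<rho>, \<theta>)))"
    by (rule integral_swap_continuous) (simp add: cont)
  also have "\<dots> = integral {0..2*pi} (\<lambda>\<theta>. r * (\<phi> (r *\<^sub>R dir \<theta>) \<bullet> dir \<theta>))"
  proof (unfold box_real(2), rule integral_cong)
    fix \<theta>
    have "((\<lambda>\<rho>. F (\<rho>, \<theta>)) has_integral r * (\<phi> (r *\<^sub>R dir \<theta>) \<bullet> dir \<theta>) - 0 * (\<phi> (0 *\<^sub>R dir \<theta>) \<bullet> dir \<theta>)) {0..r}"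
      unfolding F_def using assms(2) by (intro fundamental_theorem_of_calculus)
         (auto simp: has_real_derivative_iff_has_vector_derivative[symmetric]
           intro: has_real_derivative_radial_flux[OF assms(1)])
    then show "integral {0..r} (\<lambda>\<rho>. F (\<rho>, \<theta>)) = r * (\<phi> (r *\<^sub>R dir \<theta>) \<bullet> dir \<theta>)"
      by (simp add: integral_unique)
  qed
  also have "\<dots> \<le> integral {0..2*pi} (\<lambda>\<theta>. r)"
    by (intro integral_le integrable_continuous_real continuous_intros
        continuous_on_test_field_compose[OF assms(1)] radial_flux_le[OF assms(1,2)] integrable_const_ivl)
  finally show "integral (cbox (0, 0) (r, 2*pi)) F \<le> 2*pi*r"
    by simp
qed

lemma integral_cball_divergence_le:
  assumes "test_field \<phi>" "0 < r"
  shows "integral (cball 0 r) (divergence \<phi>) \<le> 2*pi*r"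
proof -
  let ?R = "\<lambda>(\<rho>, \<theta>).
      \<phi> (\<rho> *\<^sub>R dir \<theta>) \<bullet> dir \<theta> + \<rho> * ((jacobian \<phi> (at (\<rho> *\<^sub>R dir \<theta>)) *v dir \<theta>) \<bullet> dir \<theta>)"
  let ?A = "\<lambda>(\<rho>, \<theta>).
      \<rho> * ((jacobian \<phi> (at (\<rho> *\<^sub>R dir \<theta>)) *v dir_perp \<theta>) \<bullet> dir_perp \<theta>) - \<phi> (\<rho> *\<^sub>R dir \<theta>) \<bullet> dir \<theta>"
  have div: "continuous_on UNIV (divergence \<phi>)"
    by (rule continuous_on_divergence[OF assms(1)])
  have "(\<lambda>v. v$1 * divergence \<phi> (polar v)) integrable_on cbox (vector [0, 0]) (vector [r, 2*pi])"
    by (intro integrable_continuous continuous_intros continuous_on_compose2[OF div continuous_on_polar]) auto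
  then have "integral (cball 0 r) (divergence \<phi>)
      = integral (cbox (0, 0) (r, 2*pi)) (\<lambda>(\<rho>, \<theta>). \<rho> * divergence \<phi> (\<rho> *\<^sub>R dir \<theta>))"
    by (simp add: integral_cball_polar[OF div assms(2)] integral_cbox_vec2 polar_def case_prod_beta' pair_of_vec_def)
  also have "\<dots> = integral (cbox (0, 0) (r, 2*pi)) (\<lambda>z. ?R z + ?A z)"
    by (intro integral_cong)
       (auto simp: divergence_eq_trace trace_eq_polar_frame simp flip: distrib_left)
  also have "\<dots> = integral (cbox (0, 0) (r, 2*pi)) ?R"
    using has_integral_add[OF integrable_integral[OF integral_radial_flux_derivative_le(1)[OF assms(1)]]
        has_integral_angular_flux_derivative[OF assms(1)]] assms(2)
    by (simp add: integral_unique)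
  also have "\<dots> \<le> 2*pi*r"
    using integral_radial_flux_derivative_le(2)[OF assms(1)] assms(2) by simp
  finally show ?thesis .
qed

section \<open>Perimeter and Cheeger constant\<close>

lemma test_field_scaleR:
  assumes "test_field \<phi>" "0 < t"
  shows "test_field (\<lambda>x. \<phi> (x /\<^sub>R t))"
    and "divergence (\<lambda>x. \<phi> (x /\<^sub>R t)) x = divergence \<phi> (x /\<^sub>R t) / t"
proof -
  have "((\<lambda>x. x /\<^sub>R t) has_derivative (\<lambda>h. h /\<^sub>R t)) (at x)" for x :: "real^2"
    by (intro derivative_eq_intros) auto
  then have "((\<lambda>x. \<phi> (x /\<^sub>R t)) has_derivative (\<lambda>h. jacobian \<phi> (at (x /\<^sub>R t)) *v (h /\<^sub>R t))) (at x)" for x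
    using has_derivative_compose test_field_has_derivative[OF assms(1)] by blast
  then have "((\<lambda>x. \<phi> (x /\<^sub>R t)) has_derivative (\<lambda>h. (jacobian \<phi> (at (x /\<^sub>R t)) /\<^sub>R t) *v h)) (at x)" for x
    by (simp add: matrix_scaleR_vector_ac)
  then have deriv: "frechet_derivative (\<lambda>x. \<phi> (x /\<^sub>R t)) (at x) = (\<lambda>h. (jacobian \<phi> (at (x /\<^sub>R t)) /\<^sub>R t) *v h)"
    and diff: "(\<lambda>x. \<phi> (x /\<^sub>R t)) differentiable (at x)" for x
    by (auto simp: differentiable_def frechet_derivative_at[symmetric])
  then have jac: "jacobian (\<lambda>x. \<phi> (x /\<^sub>R t)) (at x) = jacobian \<phi> (at (x /\<^sub>R t)) /\<^sub>R t" for x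
    by (simp add: jacobian_def)
  have "trace (c *\<^sub>R A) = c * trace A" for c and A :: "real^2^2"
    by (simp add: trace_def sum_distrib_left)
  then show "divergence (\<lambda>x. \<phi> (x /\<^sub>R t)) x = divergence \<phi> (x /\<^sub>R t) / t"
    by (simp add: divergence_eq_trace jac divide_inverse mult.commute)
  have "{x. \<phi> (x /\<^sub>R t) \<noteq> 0} = (*\<^sub>R) t ` {y. \<phi> y \<noteq> 0}"
    using assms(2) by (auto simp: image_iff intro!: exI[of _ "_ /\<^sub>R t"])
  then have "compact (closure {x. \<phi> (x /\<^sub>R t) \<noteq> 0})"
    using assms(1) by (simp add: test_field_def closure_scaleR[symmetric] compact_scaling)
  moreover have "continuous_on UNIV (\<lambda>x. jacobian (\<lambda>x. \<phi> (x /\<^sub>R t)) (at x))"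
    unfolding jac[abs_def] by (intro continuous_intros assms(1))
  ultimately show "test_field (\<lambda>x. \<phi> (x /\<^sub>R t))"
    using assms(1) diff by (simp add: test_field_iff)
qed

lemma lebesgue_integral_scaleR_inverse:
  fixes f :: "'a::euclidean_space \<Rightarrow> real"
  assumes f: "f \<in> borel_measurable lebesgue" and "0 < t"
  shows "integral\<^sup>L lebesgue (\<lambda>x. f (x /\<^sub>R t)) = t ^ DIM('a) * integral\<^sup>L lebesgue f"
proof -
  let ?T = "\<lambda>x::'a. x /\<^sub>R t"
  have "(\<Sum>j\<in>Basis. (inverse t * (x \<bullet> j)) *\<^sub>R j) = inverse t *\<^sub>R (\<Sum>j\<in>Basis. (x \<bullet> j) *\<^sub>R j)" for x :: 'a
    by (simp add: scaleR_sum_right)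
  then have T: "(\<lambda>x. 0 + (\<Sum>j\<in>Basis. (inverse t * (x \<bullet> j)) *\<^sub>R j)) = ?T"
    by (simp add: euclidean_representation fun_eq_iff)
  have "lebesgue = density (distr lebesgue lebesgue ?T) (\<lambda>_. (\<Prod>j\<in>(Basis::'a set). \<bar>inverse t\<bar>))"
    using lebesgue_affine_euclidean[of "\<lambda>_::'a. inverse t" 0] \<open>0 < t\<close> unfolding T by simp
  then have L: "lebesgue = density (distr lebesgue lebesgue ?T) (\<lambda>_. ennreal (inverse t ^ DIM('a)))"
    using \<open>0 < t\<close> by simp
  have Tm: "?T \<in> lebesgue \<rightarrow>\<^sub>M lebesgue"
    using lebesgue_affine_measurable[of "\<lambda>_::'a. inverse t" 0] \<open>0 < t\<close> unfolding T by simp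
  have "integral\<^sup>L lebesgue f = integral\<^sup>L (distr lebesgue lebesgue ?T) (\<lambda>x. inverse t ^ DIM('a) *\<^sub>R f x)"
    by (subst L) (rule integral_density, use f \<open>0 < t\<close> in auto)
  also have "\<dots> = inverse t ^ DIM('a) * integral\<^sup>L lebesgue (\<lambda>x. f (?T x))"
    using f by (subst integral_distr[OF Tm]) auto
  finally show ?thesis
    using \<open>0 < t\<close> by (simp add: field_simps)
qed

lemma continuous_imp_borel_measurable_lebesgue:
  "continuous_on UNIV f \<Longrightarrow> f \<in> borel_measurable lebesgue"
  by (rule measurable_completion) (simp add: borel_measurable_continuous_onI)

lemma perimeter_nonneg: "0 \<le> perimeter E"
proof -
  have "frechet_derivative (\<lambda>x. 0::real^2) (at x) = (\<lambda>h. 0)" for x :: "real^2"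
    by (rule frechet_derivative_at[symmetric]) simp
  then have "test_field (\<lambda>x. 0)" "divergence (\<lambda>x. 0) x = 0" for x :: "real^2"
    by (simp_all add: test_field_iff jacobian_def divergence_def)
  then show ?thesis
    unfolding perimeter_def zero_ereal_def[symmetric] by (intro SUP_upper2[of "\<lambda>x. 0"]) auto
qed

lemma perimeter_scaleR_ge:
  assumes E: "E \<in> sets lebesgue" and "0 < t"
  shows "ereal t * perimeter E \<le> perimeter ((*\<^sub>R) t ` E)"
proof -
  have "perimeter E \<le> perimeter ((*\<^sub>R) t ` E) / ereal t"
    unfolding perimeter_def[of E]
  proof (rule SUP_least)
    fix \<phi>
    assume "\<phi> \<in> {\<phi>. test_field \<phi>}"
    then have \<phi>: "test_field \<phi>"
      by simp
    let ?\<psi> = "\<lambda>x. \<phi> (x /\<^sub>R t)"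
    have "x \<in> (*\<^sub>R) t ` E \<longleftrightarrow> x /\<^sub>R t \<in> E" for x
      using \<open>0 < t\<close> by (auto simp: image_iff intro: bexI[of _ "x /\<^sub>R t"])
    then have "integral\<^sup>L lebesgue (\<lambda>x. indicator ((*\<^sub>R) t ` E) x * divergence ?\<psi> x)
        = integral\<^sup>L lebesgue (\<lambda>x. (\<lambda>y. indicator E y * divergence \<phi> y / t) (x /\<^sub>R t))"
      by (simp add: indicator_def test_field_scaleR(2)[OF \<phi> \<open>0 < t\<close>])
    also have "\<dots> = t * integral\<^sup>L lebesgue (\<lambda>x. indicator E x * divergence \<phi> x)"
    proof (subst lebesgue_integral_scaleR_inverse)
      show "(\<lambda>y. indicator E y * divergence \<phi> y / t) \<in> borel_measurable lebesgue"
        using E continuous_imp_borel_measurable_lebesgue[OF continuous_on_divergence[OF \<phi>]]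
        by measurable
    qed (use \<open>0 < t\<close> in \<open>simp_all add: power2_eq_square\<close>)
    finally have "ereal t * ereal (integral\<^sup>L lebesgue (\<lambda>x. indicator E x * divergence \<phi> x))
        \<le> perimeter ((*\<^sub>R) t ` E)"
      unfolding perimeter_def using test_field_scaleR(1)[OF \<phi> \<open>0 < t\<close>]
      by (auto intro!: SUP_upper2[of ?\<psi>])
    then show "ereal (integral\<^sup>L lebesgue (\<lambda>x. indicator E x * divergence \<phi> x))
        \<le> perimeter ((*\<^sub>R) t ` E) / ereal t"
      using \<open>0 < t\<close> by (subst ereal_le_divide_pos) (auto simp: mult.commute)
  qed
  then show ?thesis
    using \<open>0 < t\<close> by (subst (asm) ereal_le_divide_pos) (auto simp: mult.commute)
qed

lemma perimeter_cball_le: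
  assumes "0 < r"
  shows "perimeter (cball 0 r) \<le> ereal (2*pi*r)"
  unfolding perimeter_def
proof (rule SUP_least)
  fix \<phi>
  assume "\<phi> \<in> {\<phi>. test_field \<phi>}"
  then have \<phi>: "test_field \<phi>"
    by simp
  have "divergence \<phi> absolutely_integrable_on cball 0 r"
    by (intro continuous_absolutely_integrable_on_bounded continuous_on_divergence[OF \<phi>]) auto
  then have "integral\<^sup>L lebesgue (\<lambda>x. indicator (cball 0 r) x * divergence \<phi> x) = integral (cball 0 r) (divergence \<phi>)"
    using set_lebesgue_integral_eq_integral(2) by (fastforce simp: set_lebesgue_integral_def)
  then show "ereal (integral\<^sup>L lebesgue (\<lambda>x. indicator (cball 0 r) x * divergence \<phi> x)) \<le> ereal (2*pi*r)"
    using integral_cball_divergence_le[OF \<phi> assms] by simp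
qed

lemma cheeger_nonneg: "0 \<le> cheeger \<Omega>"
  unfolding cheeger_def by (rule INF_greatest) (auto intro!: zero_le_divide_ereal perimeter_nonneg)

lemma cheeger_le:
  "E \<in> sets lebesgue \<Longrightarrow> E \<subseteq> \<Omega> \<Longrightarrow> 0 < measure lebesgue E \<Longrightarrow>
     cheeger \<Omega> \<le> perimeter E / ereal (measure lebesgue E)"
  unfolding cheeger_def by (rule INF_lower) auto

lemma cheeger_antimono: "\<Omega> \<subseteq> \<Omega>' \<Longrightarrow> cheeger \<Omega>' \<le> cheeger \<Omega>"
  unfolding cheeger_def by (rule INF_superset_mono) auto

lemma cheeger_scaleR_ge:
  assumes "0 < t"
  shows "cheeger \<Omega> / ereal t \<le> cheeger ((*\<^sub>R) t ` \<Omega>)"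
  unfolding cheeger_def[of "(*\<^sub>R) t ` \<Omega>"]
proof (rule INF_greatest)
  fix E'
  assume "E' \<in> {E. E \<in> sets lebesgue \<and> E \<subseteq> (*\<^sub>R) t ` \<Omega> \<and> 0 < measure lebesgue E}"
  then have E': "E' \<in> sets lebesgue" "E' \<subseteq> (*\<^sub>R) t ` \<Omega>" "0 < measure lebesgue E'"
    by auto
  define E where "E = (*\<^sub>R) t -` E'"
  have E: "E \<in> sets lebesgue"
    using measurable_sets[OF lebesgue_measurable_scaling E'(1), of t] by (simp add: E_def)
  have "surj ((*\<^sub>R) t :: real^2 \<Rightarrow> real^2)"
    using \<open>0 < t\<close> by (intro surjI[of _ "\<lambda>x. x /\<^sub>R t"]) simp
  then have E'_eq: "E' = (*\<^sub>R) t ` E"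
    by (simp add: E_def)
  then have "E \<subseteq> \<Omega>"
    using E'(2) \<open>0 < t\<close> by (auto simp: E_def)
  have mE: "measure lebesgue E' = t\<^sup>2 * measure lebesgue E"
    using measure_lebesgue_affine[of t 0 E] \<open>0 < t\<close> by (simp add: E'_eq)
  then have "0 < measure lebesgue E"
    using E'(3) by (simp add: zero_less_mult_iff)
  then have h: "ereal (measure lebesgue E) * cheeger \<Omega> \<le> perimeter E"
    using cheeger_le[OF E \<open>E \<subseteq> \<Omega>\<close>] by (simp add: ereal_le_divide_pos)
  have P: "ereal t * perimeter E \<le> perimeter E'"
    unfolding E'_eq by (rule perimeter_scaleR_ge[OF E \<open>0 < t\<close>])
  have "ereal (measure lebesgue E') * (cheeger \<Omega> / ereal t)
      = ereal t * (ereal (measure lebesgue E) * cheeger \<Omega>)"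
    using \<open>0 < t\<close> \<open>0 < measure lebesgue E\<close>
    by (cases "cheeger \<Omega>") (simp_all add: mE power2_eq_square field_simps)
  also have "\<dots> \<le> perimeter E'"
    using h P \<open>0 < t\<close> by (meson ereal_mult_left_mono ereal_less_eq(5) less_imp_le order_trans)
  finally show "cheeger \<Omega> / ereal t \<le> perimeter E' / ereal (measure lebesgue E')"
    using E'(3) by (simp add: ereal_le_divide_pos)
qed

lemma cheeger_le_of_cball_subset:
  assumes "0 < r" "cball 0 r \<subseteq> \<Omega>"
  shows "cheeger \<Omega> \<le> ereal (2 / r)"
proof -
  have m: "measure lebesgue (cball (0::real^2) r) = pi * r\<^sup>2"
    using assms(1) by (simp add: content_cball unit_ball_vol_2)
  have "cheeger \<Omega> \<le> perimeter (cball 0 r) / ereal (measure lebesgue (cball (0::real^2) r))"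
    using assms m by (intro cheeger_le) auto
  also have "\<dots> \<le> ereal (2*pi*r) / ereal (pi * r\<^sup>2)"
    unfolding m using assms(1) by (intro ereal_divide_right_mono perimeter_cball_le) auto
  also have "\<dots> = ereal (2 / r)"
    using assms(1) by (simp add: power2_eq_square)
  finally show ?thesis .
qed

lemma ereal_abs_diff_le_of_scaled:
  fixes a b :: ereal
  assumes "0 \<le> a" "a \<le> ereal M" "0 \<le> b" "b \<le> ereal M" "0 \<le> \<delta>"
    and "b / ereal (1 + \<delta>) \<le> a" "a / ereal (1 + \<delta>) \<le> b"
  shows "\<bar>a - b\<bar> \<le> ereal (M * \<delta>)"
proof -
  obtain x y where xy: "a = ereal x" "b = ereal y"
    using assms(1-4) by (cases a; cases b) auto
  have "y \<le> x * (1 + \<delta>)" "x \<le> y * (1 + \<delta>)"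
    using assms(5-7) by (simp_all add: xy pos_divide_le_eq add_pos_nonneg)
  moreover have "x * \<delta> \<le> M * \<delta>" "y * \<delta> \<le> M * \<delta>"
    using assms(2,4,5) by (simp_all add: xy mult_right_mono)
  ultimately show ?thesis
    by (simp add: xy algebra_simps)
qed

lemma cheeger_diff_le:
  assumes "compact \<Omega>1" "compact \<Omega>2" "starshaped0 \<Omega>1" "starshaped0 \<Omega>2" "0 < r0"
    and "\<forall>\<theta>\<in>{0..<2*pi}. radial_fun \<Omega>1 \<theta> \<ge> r0" "\<forall>\<theta>\<in>{0..<2*pi}. radial_fun \<Omega>2 \<theta> \<ge> r0"
  shows "\<bar>cheeger \<Omega>1 - cheeger \<Omega>2\<bar>
           \<le> ereal (2 / r0^2 * sup_norm (\<lambda>\<theta>. radial_fun \<Omega>1 \<theta> - radial_fun \<Omega>2 \<theta>))"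
proof -
  let ?\<epsilon> = "sup_norm (\<lambda>\<theta>. radial_fun \<Omega>1 \<theta> - radial_fun \<Omega>2 \<theta>)"
  let ?c = "1 + ?\<epsilon> / r0"
  have \<epsilon>: "\<bar>radial_fun \<Omega>1 t - radial_fun \<Omega>2 t\<bar> \<le> ?\<epsilon>" if "0 \<le> t" "t < 2*pi" for t
    using radial_fun_diff_le_sup_norm[OF assms(1,3,2,4) that] .
  have "\<bar>radial_fun \<Omega>1 0 - radial_fun \<Omega>2 0\<bar> \<le> ?\<epsilon>"
    by (rule \<epsilon>) simp_all
  then have "0 \<le> ?\<epsilon>"
    by (rule order_trans[OF abs_ge_zero])
  then have c: "0 < ?c"
    using assms(5) by (simp add: add_pos_nonneg)
  have \<epsilon>': "radial_fun \<Omega>1 t \<le> radial_fun \<Omega>2 t + ?\<epsilon>" "radial_fun \<Omega>2 t \<le> radial_fun \<Omega>1 t + ?\<epsilon>"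
    if "0 \<le> t" "t < 2*pi" for t
    using \<epsilon>[OF that] unfolding abs_le_iff by linarith+
  have "\<Omega>1 \<subseteq> (*\<^sub>R) ?c ` \<Omega>2"
    using assms(6,7) \<epsilon>' by (intro starshaped_subset_scaleR assms(1-5) \<open>0 \<le> ?\<epsilon>\<close>) auto
  then have h21: "cheeger \<Omega>2 / ereal ?c \<le> cheeger \<Omega>1"
    using cheeger_scaleR_ge[OF c, of \<Omega>2] cheeger_antimono order_trans by blast
  have "\<Omega>2 \<subseteq> (*\<^sub>R) ?c ` \<Omega>1"
    using assms(6,7) \<epsilon>' by (intro starshaped_subset_scaleR assms(1-5) \<open>0 \<le> ?\<epsilon>\<close>) auto
  then have h12: "cheeger \<Omega>1 / ereal ?c \<le> cheeger \<Omega>2"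
    using cheeger_scaleR_ge[OF c, of \<Omega>1] cheeger_antimono order_trans by blast
  have "cheeger \<Omega>1 \<le> ereal (2 / r0)" "cheeger \<Omega>2 \<le> ereal (2 / r0)"
    using cball_subset_starshaped[OF assms(1,3,6)] cball_subset_starshaped[OF assms(2,4,7)] assms(5)
    by (simp_all add: cheeger_le_of_cball_subset)
  then have "\<bar>cheeger \<Omega>1 - cheeger \<Omega>2\<bar> \<le> ereal (2 / r0 * (?\<epsilon> / r0))"
    using h12 h21 cheeger_nonneg \<open>0 \<le> ?\<epsilon>\<close> assms(5)
    by (intro ereal_abs_diff_le_of_scaled) auto
  then show ?thesis
    by (simp add: power2_eq_square)
qed

theorem lemma2p4:
  fixes \<Omega>1 \<Omega>2 :: "(real^2) set" and r0 :: real
  assumes "compact \<Omega>1" and "compact \<Omega>2"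
    and "starshaped0 \<Omega>1" and "starshaped0 \<Omega>2"
    and "r0 > 0"
    and "\<forall>\<theta>\<in>{0..<2*pi}. radial_fun \<Omega>1 \<theta> \<ge> r0"
    and "\<forall>\<theta>\<in>{0..<2*pi}. radial_fun \<Omega>2 \<theta> \<ge> r0"
  shows "\<bar>cheeger \<Omega>1 - cheeger \<Omega>2\<bar>
           \<le> ereal (2 / r0^2 * sup_norm (\<lambda>\<theta>. radial_fun \<Omega>1 \<theta> - radial_fun \<Omega>2 \<theta>))
    \<and> \<bar>measure lebesgue \<Omega>1 - measure lebesgue \<Omega>2\<bar>
           \<le> 2 * pi * max (sup_norm (radial_fun \<Omega>1)) (sup_norm (radial_fun \<Omega>2))
               * sup_norm (\<lambda>\<theta>. radial_fun \<Omega>1 \<theta> - radial_fun \<Omega>2 \<theta>)"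
  using cheeger_diff_le[OF assms] measure_starshaped_diff_le[OF assms(1,3,2,4)] by blast

end
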